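(* Let $\mathcal{A}$ be a finite collection of hyperplanes in $\mathbb{R}^d$ with $\bigcap_{H\in\mathcal{A}}H=\{0\}$, and let $\mathcal{F}$ be the associated hyperplane face monoid. If $\mathcal{F}$ is non-trivial (has more than one element), then $\mathcal{F}$ is not Ramsey.
   Context: Hyperplane face monoid: for each $H\in\mathcal{A}$ let $H^+,H^-$ be the two open half-spaces determined by $H$ (with a fixed choice of which is which), and $H^0=H$. A face is a nonempty set of the form $A=\bigcap_{H\in\mathcal{A}}H^{\sigma_H(A)}$ with $\sigma_H(A)\in\{-,+,0\}$; it is determined by its sign sequence $(\sigma_H(A))_{H\in\mathcal{A}}$. $\mathcal{F}$ is the set of all faces, with product $AB$ the face whose sign sequence is $\sigma_H(AB)=\sigma_H(A)$ if $\sigma_H(A)\neq 0$ and $\sigma_H(AB)=\sigma_H(B)$ if $\sigma_H(A)=0$. This is a monoid with identity $\{0\}$. Ramsey monoids: let $M$ be a finite monoid. A pointed $M$-set is a set $X$ with an action of $M$ and a distinguished point $x\in X$ such that $Mx=X$. Given a sequence $(X_n)_{n\in\mathbb{N}}$ of pointed $M$-sets, treated as mutually disjoint, let $\langle (X_n)\rangle$ be the set of all finite partial functions $f:\mathbb{N}\to\bigcup_n X_n$ with $f(n)\in X_n$ for all $n\in\operatorname{dom}(f)$. For $f,g\in\langle (X_n)\rangle$ write $f\prec g$ if $\max(\operatorname{dom}(f))<\min(\operatorname{dom}(g))$; in that case the product $fg$ is defined to be $f\cup g\in\langle (X_n)\rangle$. $M$ acts on $\langle (X_n)\rangle$ coordinatewise: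 $m(f)$ has the same domain as $f$ and $m(f)(n)=m\cdot f(n)$. The sequence $(X_n)$ has the Ramsey property if for every finite colouring of $\langle (X_n)\rangle$ there is a sequence $B=\{f_i\}_{i\in\mathbb{N}}\subseteq\langle (X_n)\rangle$ such that: (1) $f_i\prec f_{i+1}$ for all $i$; (2) for each $i$, the range of $f_i$ includes the distinguished element of $X_n$ for some $n\in\operatorname{dom}(f_i)$; (3) the set $[B]=\{m_0(f_{i_0})\cdots m_k(f_{i_k}) : k\in\mathbb{N},\ i_0<\dots<i_k,\ m_j\in M \text{ for all } j,\ m_j=1_M\text{ for at least one } j\}$ is monochromatic. $M$ is Ramsey if every sequence of pointed $M$-sets has the Ramsey property. *)

theory Defs
  imports "HOL-Analysis.Analysis" "HOL-Algebra.Group"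
begin

section \<open>Hyperplane face monoids\<close>

definition hyperplane :: "(real ^ 'd) set \<Rightarrow> bool" where
  "hyperplane H \<longleftrightarrow> (\<exists>a b. a \<noteq> 0 \<and> H = {x. a \<bullet> x = b})"

text \<open>\<open>P\<close> and \<open>N\<close> are the two open half-spaces determined by \<open>H\<close>. Since \<open>(a, b)\<close> may be replaced
  by \<open>(-a, -b)\<close>, either one can be the positive side.\<close>

definition half_spaces :: "(real ^ 'd) set \<Rightarrow> (real ^ 'd) set \<Rightarrow> (real ^ 'd) set \<Rightarrow> bool" where
  "half_spaces H P N \<longleftrightarrow>
     (\<exists>a b. a \<noteq> 0 \<and> H = {x. a \<bullet> x = b} \<and> P = {x. a \<bullet> x > b} \<and> N = {x. a \<bullet> x < b})"

datatype sign = SNeg | SZero | SPos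

text \<open>Below, \<open>pos H\<close> and \<open>neg H\<close> are the half-spaces written $H^+$ and $H^-$.\<close>

fun side :: "('a set \<Rightarrow> 'a set) \<Rightarrow> ('a set \<Rightarrow> 'a set) \<Rightarrow> 'a set \<Rightarrow> sign \<Rightarrow> 'a set" where
  "side pos neg H SNeg = neg H"
| "side pos neg H SZero = H"
| "side pos neg H SPos = pos H"

definition cell ::
  "'a set set \<Rightarrow> ('a set \<Rightarrow> 'a set) \<Rightarrow> ('a set \<Rightarrow> 'a set) \<Rightarrow> ('a set \<Rightarrow> sign) \<Rightarrow> 'a set" where
  "cell \<A> pos neg \<sigma> = (\<Inter>H\<in>\<A>. side pos neg H (\<sigma> H))"

definition faces ::
  "'a set set \<Rightarrow> ('a set \<Rightarrow> 'a set) \<Rightarrow> ('a set \<Rightarrow> 'a set) \<Rightarrow> 'a set set" where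
  "faces \<A> pos neg = {F. F \<noteq> {} \<and> (\<exists>\<sigma>. F = cell \<A> pos neg \<sigma>)}"

definition sign_seq ::
  "'a set set \<Rightarrow> ('a set \<Rightarrow> 'a set) \<Rightarrow> ('a set \<Rightarrow> 'a set) \<Rightarrow> 'a set \<Rightarrow> 'a set \<Rightarrow> sign" where
  "sign_seq \<A> pos neg F = (THE \<sigma>. \<sigma> \<in> extensional \<A> \<and> F = cell \<A> pos neg \<sigma>)"

definition face_mult ::
  "'a set set \<Rightarrow> ('a set \<Rightarrow> 'a set) \<Rightarrow> ('a set \<Rightarrow> 'a set) \<Rightarrow> 'a set \<Rightarrow> 'a set \<Rightarrow> 'a set" where
  "face_mult \<A> pos neg A B =
     cell \<A> pos neg
       (\<lambda>H. if sign_seq \<A> pos neg A H \<noteq> SZero then sign_seq \<A> pos neg A H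
            else sign_seq \<A> pos neg B H)"

definition face_monoid ::
  "(real ^ 'd) set set \<Rightarrow> ((real ^ 'd) set \<Rightarrow> (real ^ 'd) set)
     \<Rightarrow> ((real ^ 'd) set \<Rightarrow> (real ^ 'd) set) \<Rightarrow> (real ^ 'd) set monoid" where
  "face_monoid \<A> pos neg =
     \<lparr>carrier = faces \<A> pos neg, monoid.mult = face_mult \<A> pos neg, one = {0}\<rparr>"


section \<open>Ramsey monoids\<close>

definition monoid_action ::
  "('m, 'e) monoid_scheme \<Rightarrow> 'x set \<Rightarrow> ('m \<Rightarrow> 'x \<Rightarrow> 'x) \<Rightarrow> bool" where
  "monoid_action M X act \<longleftrightarrow>
     (\<forall>m\<in>carrier M. \<forall>x\<in>X. act m x \<in> X) \<and>
     (\<forall>x\<in>X. act \<one>\<^bsub>M\<^esub> x = x) \<and>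
     (\<forall>m\<in>carrier M. \<forall>m'\<in>carrier M. \<forall>x\<in>X. act (m \<otimes>\<^bsub>M\<^esub> m') x = act m (act m' x))"

definition pointed_set ::
  "('m, 'e) monoid_scheme \<Rightarrow> 'x set \<Rightarrow> ('m \<Rightarrow> 'x \<Rightarrow> 'x) \<Rightarrow> 'x \<Rightarrow> bool" where
  "pointed_set M X act p \<longleftrightarrow>
     monoid_action M X act \<and> p \<in> X \<and> (\<lambda>m. act m p) ` carrier M = X"

text \<open>The sets \<open>X n\<close> need not be literally disjoint: the value of \<open>f\<close> at \<open>n\<close> is always read as an
  element of the \<open>n\<close>-th set, so that the index \<open>n\<close> plays the role of the disjointness convention.\<close>

definition partial_sections :: "(nat \<Rightarrow> 'x set) \<Rightarrow> (nat \<rightharpoonup> 'x) set" where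
  "partial_sections X = {f. finite (dom f) \<and> (\<forall>n\<in>dom f. the (f n) \<in> X n)}"

definition prec :: "(nat \<rightharpoonup> 'x) \<Rightarrow> (nat \<rightharpoonup> 'x) \<Rightarrow> bool" where
  "prec f g \<longleftrightarrow> dom f \<noteq> {} \<and> dom g \<noteq> {} \<and> Max (dom f) < Min (dom g)"

definition section_act :: "(nat \<Rightarrow> 'm \<Rightarrow> 'x \<Rightarrow> 'x) \<Rightarrow> 'm \<Rightarrow> (nat \<rightharpoonup> 'x) \<Rightarrow> (nat \<rightharpoonup> 'x)" where
  "section_act act m f = (\<lambda>n. map_option (act n m) (f n))"

text \<open>The product \<open>f \<union> g\<close> of \<open>prec f g\<close> is \<open>f ++ g\<close>; all products formed in \<open>ramsey_span\<close> are of
  this kind as soon as \<open>prec (f i) (f (Suc i))\<close> for all \<open>i\<close>.\<close>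

definition ramsey_span ::
  "('m, 'e) monoid_scheme \<Rightarrow> (nat \<Rightarrow> 'm \<Rightarrow> 'x \<Rightarrow> 'x) \<Rightarrow> (nat \<Rightarrow> (nat \<rightharpoonup> 'x)) \<Rightarrow> (nat \<rightharpoonup> 'x) set" where
  "ramsey_span M act f =
     {foldr (++) (map (\<lambda>j. section_act act (m j) (f (i j))) [0..<Suc k]) Map.empty | k i m.
        strict_mono_on {..k} i \<and> (\<forall>j\<le>k. m j \<in> carrier M) \<and> (\<exists>j\<le>k. m j = \<one>\<^bsub>M\<^esub>)}"

definition ramsey_property ::
  "('m, 'e) monoid_scheme \<Rightarrow> (nat \<Rightarrow> 'x set) \<Rightarrow> (nat \<Rightarrow> 'm \<Rightarrow> 'x \<Rightarrow> 'x) \<Rightarrow> (nat \<Rightarrow> 'x) \<Rightarrow> bool" where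
  "ramsey_property M X act p \<longleftrightarrow>
     (\<forall>c :: (nat \<rightharpoonup> 'x) \<Rightarrow> nat. finite (c ` partial_sections X) \<longrightarrow>
       (\<exists>f :: nat \<Rightarrow> (nat \<rightharpoonup> 'x).
          (\<forall>i. f i \<in> partial_sections X) \<and>
          (\<forall>i. prec (f i) (f (Suc i))) \<and>
          (\<forall>i. \<exists>n\<in>dom (f i). f i n = Some (p n)) \<and>
          (\<exists>r. \<forall>g\<in>ramsey_span M act f. c g = r)))"

text \<open>A pointed \<open>M\<close>-set has at most as many elements as \<open>M\<close>, so it is no restriction to let the
  pointed \<open>M\<close>-sets live in the type of the elements of \<open>M\<close>; see \<open>ramsey_monoidD\<close> below.\<close>

definition ramsey_monoid :: "('m, 'e) monoid_scheme \<Rightarrow> bool" where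
  "ramsey_monoid M \<longleftrightarrow>
     (\<forall>(X :: nat \<Rightarrow> 'm set) act p.
        (\<forall>n. pointed_set M (X n) (act n) (p n)) \<longrightarrow> ramsey_property M X act p)"

lemma ramsey_monoidD:
  fixes M :: "('m, 'e) monoid_scheme" and X :: "nat \<Rightarrow> 'x set"
  assumes M: "ramsey_monoid M" and X: "\<And>n. pointed_set M (X n) (act n) (p n)"
  shows "ramsey_property M X act p"
  unfolding ramsey_property_def
proof (intro allI impI)
  fix c :: "(nat \<rightharpoonup> 'x) \<Rightarrow> nat" assume fin: "finite (c ` partial_sections X)"
  define h where "h n x = (SOME m. m \<in> carrier M \<and> act n m (p n) = x)" for n x
  have h: "act n (h n x) (p n) = x" if "x \<in> X n" for n x
  proof -
    have "x \<in> (\<lambda>m. act n m (p n)) ` carrier M"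
      using X[of n] that by (simp add: pointed_set_def)
    then have "\<exists>m. m \<in> carrier M \<and> act n m (p n) = x"
      by (elim imageE) (intro exI conjI, simp_all)
    from someI_ex[OF this] show ?thesis unfolding h_def by (rule conjunct2)
  qed
  define g where "g n m = act n m (p n)" for n m
  have gh [simp]: "g n (h n x) = x" if "x \<in> X n" for n x
    unfolding g_def using that by (rule h)
  define Y where "Y n = h n ` X n" for n
  define a where "a n m y = h n (act n m (g n y))" for n m y
  define q where "q n = h n (p n)" for n
  have gY: "g n y \<in> X n" if "y \<in> Y n" for n y
    using that by (auto simp: Y_def)
  have closed: "act n m x \<in> X n" if "m \<in> carrier M" "x \<in> X n" for n m x
    using X[of n] that unfolding pointed_set_def monoid_action_def by blast
  have pX: "p n \<in> X n" for n
    using X[of n] by (auto simp: pointed_set_def)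
  have Y: "pointed_set M (Y n) (a n) (q n)" for n
  proof -
    have "monoid_action M (Y n) (a n)"
      using X[of n] closed by (auto simp: pointed_set_def monoid_action_def a_def Y_def)
    moreover have "(\<lambda>m. a n m (q n)) ` carrier M = h n ` ((\<lambda>m. act n m (p n)) ` carrier M)"
      using pX by (simp add: a_def q_def image_image)
    ultimately show ?thesis
      using X[of n] unfolding pointed_set_def q_def Y_def by simp
  qed
  define T where "T f = (\<lambda>n. map_option (g n) (f n))" for f
  have T: "T f \<in> partial_sections X" if "f \<in> partial_sections Y" for f
  proof -
    have "dom (T f) = dom f" by (auto simp: T_def)
    moreover have "the (T f n) \<in> X n" if "n \<in> dom f" for n
    proof -
      have "the (f n) \<in> Y n"
        using that \<open>f \<in> partial_sections Y\<close> by (simp add: partial_sections_def)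
      then show ?thesis using that gY by (auto simp: T_def)
    qed
    ultimately show ?thesis using that by (simp add: partial_sections_def)
  qed
  have "finite ((c \<circ> T) ` partial_sections Y)"
    by (rule finite_subset[OF _ fin]) (use T in auto)
  moreover have "ramsey_property M Y a q"
    using M Y by (simp add: ramsey_monoid_def)
  ultimately have "\<exists>f. (\<forall>i. f i \<in> partial_sections Y) \<and> (\<forall>i. prec (f i) (f (Suc i))) \<and>
      (\<forall>i. \<exists>n\<in>dom (f i). f i n = Some (q n)) \<and> (\<exists>r. \<forall>g\<in>ramsey_span M a f. (c \<circ> T) g = r)"
    unfolding ramsey_property_def by (elim allE impE)
  then obtain f r where f: "\<And>i. f i \<in> partial_sections Y" "\<And>i. prec (f i) (f (Suc i))"
    "\<And>i. \<exists>n\<in>dom (f i). f i n = Some (q n)" "\<And>u. u \<in> ramsey_span M a f \<Longrightarrow> c (T u) = r"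
    unfolding comp_def by blast
  have domT: "dom (T u) = dom u" for u
    by (auto simp: T_def)
  have Tadd: "T (u ++ v) = T u ++ T v" for u v
    by (auto simp: T_def map_add_def split: option.splits)
  have Tact: "T (section_act a m u) = section_act act m (T u)"
    if "u \<in> partial_sections Y" "m \<in> carrier M" for u m
  proof
    fix n
    show "T (section_act a m u) n = section_act act m (T u) n"
    proof (cases "u n")
      case (Some y)
      then have "y \<in> Y n" using that by (force simp: partial_sections_def)
      then show ?thesis using Some that closed gY by (simp add: T_def section_act_def a_def)
    qed (simp add: T_def section_act_def)
  qed
  have Tfold: "T (foldr (++) us Map.empty) = foldr (++) (map T us) Map.empty" for us
    by (induction us) (simp_all add: Tadd, simp add: T_def)
  have mono: "c u = r" if u': "u \<in> ramsey_span M act (\<lambda>i. T (f i))" for u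
  proof -
    obtain k i m where u: "u = foldr (++)
        (map (\<lambda>j. section_act act (m j) (T (f (i j)))) [0..<Suc k]) Map.empty"
      and *: "strict_mono_on {..k} i" "\<forall>j\<le>k. m j \<in> carrier M" "\<exists>j\<le>k. m j = \<one>\<^bsub>M\<^esub>"
      using u' unfolding ramsey_span_def by blast
    let ?v = "foldr (++) (map (\<lambda>j. section_act a (m j) (f (i j))) [0..<Suc k]) Map.empty"
    have "map (\<lambda>j. section_act act (m j) (T (f (i j)))) [0..<Suc k] =
        map T (map (\<lambda>j. section_act a (m j) (f (i j))) [0..<Suc k])"
      unfolding map_map by (rule map_cong) (use * f(1) in \<open>auto simp: Tact less_Suc_eq_le\<close>)
    then have "u = T ?v" by (simp only: u Tfold)
    moreover have "?v \<in> ramsey_span M a f"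
      unfolding ramsey_span_def using * by blast
    ultimately show ?thesis using f(4) by blast
  qed
  show "\<exists>f. (\<forall>i. f i \<in> partial_sections X) \<and> (\<forall>i. prec (f i) (f (Suc i))) \<and>
          (\<forall>i. \<exists>n\<in>dom (f i). f i n = Some (p n)) \<and> (\<exists>r. \<forall>g\<in>ramsey_span M act f. c g = r)"
  proof (intro exI[of _ "\<lambda>i. T (f i)"] conjI allI)
    show "T (f i) \<in> partial_sections X" for i using T f by blast
    show "prec (T (f i)) (T (f (Suc i)))" for i using f(2)[of i] by (simp add: prec_def domT)
    show "\<exists>n\<in>dom (T (f i)). T (f i) n = Some (p n)" for i
    proof -
      obtain n where "n \<in> dom (f i)" "f i n = Some (q n)" using f(3)[of i] by blast
      then have "n \<in> dom (T (f i))" "T (f i) n = Some (p n)"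
        unfolding domT by (simp_all add: T_def q_def pX)
      then show ?thesis by blast
    qed
    show "\<exists>r. \<forall>g\<in>ramsey_span M act (\<lambda>i. T (f i)). c g = r" using mono by blast
  qed
qed


section \<open>The face monoid is a finite monoid\<close>

lemma finite_faces:
  assumes "finite \<A>"
  shows "finite (faces \<A> pos neg)"
proof -
  have "(UNIV :: sign set) = {SNeg, SZero, SPos}"
    using sign.exhaust by blast
  then have "finite (UNIV :: sign set)" by (metis finite.emptyI finite.insertI)
  then have "finite (cell \<A> pos neg ` (\<A> \<rightarrow>\<^sub>E (UNIV :: sign set)))"
    using assms by (intro finite_imageI finite_PiE) auto
  moreover have "cell \<A> pos neg \<sigma> \<in> cell \<A> pos neg ` (\<A> \<rightarrow>\<^sub>E UNIV)" for \<sigma>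
    by (rule image_eqI[of _ _ "restrict \<sigma> \<A>"]) (simp_all add: cell_def)
  then have "faces \<A> pos neg \<subseteq> cell \<A> pos neg ` (\<A> \<rightarrow>\<^sub>E UNIV)"
    unfolding faces_def by blast
  ultimately show ?thesis by (rule finite_subset[rotated])
qed

lemma side_unique:
  assumes "half_spaces H (pos H) (neg H)" "x \<in> side pos neg H s" "x \<in> side pos neg H t"
  shows "s = t"
  using assms by (cases s; cases t) (auto simp: half_spaces_def)

lemma sign_seq_cell:
  assumes hs: "\<And>H. H \<in> \<A> \<Longrightarrow> half_spaces H (pos H) (neg H)"
    and ne: "cell \<A> pos neg \<sigma> \<noteq> {}" and H: "H \<in> \<A>"
  shows "sign_seq \<A> pos neg (cell \<A> pos neg \<sigma>) H = \<sigma> H"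
proof -
  obtain x where x: "x \<in> cell \<A> pos neg \<sigma>" using ne by blast
  have "sign_seq \<A> pos neg (cell \<A> pos neg \<sigma>) = restrict \<sigma> \<A>"
    unfolding sign_seq_def
  proof (rule the_equality)
    show "restrict \<sigma> \<A> \<in> extensional \<A> \<and>
        cell \<A> pos neg \<sigma> = cell \<A> pos neg (restrict \<sigma> \<A>)"
      by (simp add: cell_def)
    fix \<tau> assume \<tau>: "\<tau> \<in> extensional \<A> \<and> cell \<A> pos neg \<sigma> = cell \<A> pos neg \<tau>"
    show "\<tau> = restrict \<sigma> \<A>"
    proof (rule extensionalityI[of _ \<A>])
      fix H assume H: "H \<in> \<A>"
      have "x \<in> side pos neg H (\<sigma> H)" "x \<in> side pos neg H (\<tau> H)"
        using x \<tau> H by (auto simp: cell_def)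
      then show "\<tau> H = restrict \<sigma> \<A> H" using side_unique[of H pos neg x] hs[OF H] H by auto
    qed (use \<tau> in auto)
  qed
  then show ?thesis using H by simp
qed

lemma face_mult_cell:
  assumes hs: "\<And>H. H \<in> \<A> \<Longrightarrow> half_spaces H (pos H) (neg H)"
    and "cell \<A> pos neg \<sigma> \<noteq> {}" "cell \<A> pos neg \<tau> \<noteq> {}"
  shows "face_mult \<A> pos neg (cell \<A> pos neg \<sigma>) (cell \<A> pos neg \<tau>) =
    cell \<A> pos neg (\<lambda>H. if \<sigma> H \<noteq> SZero then \<sigma> H else \<tau> H)"
proof -
  have cong: "cell \<A> pos neg \<rho> = cell \<A> pos neg \<rho>'" if "\<And>H. H \<in> \<A> \<Longrightarrow> \<rho> H = \<rho>' H" for \<rho> \<rho>'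
    using that by (simp add: cell_def)
  have "sign_seq \<A> pos neg (cell \<A> pos neg \<sigma>) H = \<sigma> H"
    "sign_seq \<A> pos neg (cell \<A> pos neg \<tau>) H = \<tau> H" if "H \<in> \<A>" for H
    using sign_seq_cell[of \<A> pos neg, OF hs _ that] assms(2,3) by blast+
  then show ?thesis
    unfolding face_mult_def by (intro cong) simp
qed

lemma cell_mult_nonempty:
  fixes \<A> :: "(real ^ 'd) set set"
  assumes fin: "finite \<A>" and hs: "\<And>H. H \<in> \<A> \<Longrightarrow> half_spaces H (pos H) (neg H)"
    and zero: "\<Inter>\<A> = {0}"
    and ne: "cell \<A> pos neg \<sigma> \<noteq> {}" "cell \<A> pos neg \<tau> \<noteq> {}"
  shows "cell \<A> pos neg (\<lambda>H. if \<sigma> H \<noteq> SZero then \<sigma> H else \<tau> H) \<noteq> {}"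
proof -
  let ?\<rho> = "\<lambda>H. if \<sigma> H \<noteq> SZero then \<sigma> H else \<tau> H"
  obtain x y where x: "x \<in> cell \<A> pos neg \<sigma>" and y: "y \<in> cell \<A> pos neg \<tau>"
    using ne by blast
  have "\<forall>\<^sub>F e in at_right 0. x + e *\<^sub>R y \<in> side pos neg H (?\<rho> H)" if H: "H \<in> \<A>" for H
  proof -
    obtain a b where ab: "H = {x. a \<bullet> x = b}" "pos H = {x. a \<bullet> x > b}" "neg H = {x. a \<bullet> x < b}"
      using hs[OF H] unfolding half_spaces_def by blast
    have "0 \<in> H" using zero H by blast
    then have b: "b = 0" by (simp add: ab(1))
    have xH: "x \<in> side pos neg H (\<sigma> H)" and yH: "y \<in> side pos neg H (\<tau> H)"
      using x y H by (auto simp: cell_def)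
    have "((\<lambda>e. a \<bullet> (x + e *\<^sub>R y)) \<longlongrightarrow> a \<bullet> (x + 0 *\<^sub>R y)) (at_right 0)"
      by (intro tendsto_intros)
    then have lim: "((\<lambda>e. a \<bullet> (x + e *\<^sub>R y)) \<longlongrightarrow> a \<bullet> x) (at_right 0)" by simp
    show ?thesis
    proof (cases "\<sigma> H")
      case SNeg
      then have "a \<bullet> x < 0" using xH ab b by simp
      then show ?thesis using order_tendstoD(2)[OF lim] SNeg ab b by simp
    next
      case SPos
      then have "a \<bullet> x > 0" using xH ab b by simp
      then show ?thesis using order_tendstoD(1)[OF lim] SPos ab b by simp
    next
      case SZero
      then have x0: "a \<bullet> x = 0" using xH ab b by simp
      have "x + e *\<^sub>R y \<in> side pos neg H (\<tau> H)" if "e > 0" for e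
        using yH that x0 ab b
        by (cases "\<tau> H") (auto simp: inner_add_right mult_pos_neg)
      then show ?thesis
        using SZero eventually_at_right_less[of 0] by (auto elim: eventually_mono)
    qed
  qed
  then have "\<forall>\<^sub>F e in at_right 0. \<forall>H\<in>\<A>. x + e *\<^sub>R y \<in> side pos neg H (?\<rho> H)"
    using fin by (intro eventually_ball_finite) auto
  then obtain e where "\<forall>H\<in>\<A>. x + e *\<^sub>R y \<in> side pos neg H (?\<rho> H)"
    using eventually_happens'[OF trivial_limit_at_right_real] by blast
  then show ?thesis unfolding cell_def by blast
qed

lemma monoid_face_monoid:
  fixes \<A> :: "(real ^ 'd) set set"
  assumes fin: "finite \<A>" and hs: "\<And>H. H \<in> \<A> \<Longrightarrow> half_spaces H (pos H) (neg H)"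
    and zero: "\<Inter>\<A> = {0}"
  shows "monoid (face_monoid \<A> pos neg)"
proof -
  let ?c = "cell \<A> pos neg"
  let ?p = "\<lambda>\<sigma> \<tau> H. if \<sigma> H \<noteq> SZero then \<sigma> H else \<tau> H"
  have mult: "face_mult \<A> pos neg (?c \<sigma>) (?c \<tau>) = ?c (?p \<sigma> \<tau>)" "?c (?p \<sigma> \<tau>) \<noteq> {}"
    if "?c \<sigma> \<noteq> {}" "?c \<tau> \<noteq> {}" for \<sigma> \<tau>
    using face_mult_cell[of \<A> pos neg, OF hs that] cell_mult_nonempty[OF fin hs zero that] by auto
  have one: "{0} = ?c (\<lambda>_. SZero)"
    using zero by (simp add: cell_def)
  have assoc: "?p (?p \<sigma> \<tau>) \<upsilon> = ?p \<sigma> (?p \<tau> \<upsilon>)" for \<sigma> \<tau> \<upsilon> :: "(real ^ 'd) set \<Rightarrow> sign"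
    by auto
  have id: "?p (\<lambda>_. SZero) \<sigma> = \<sigma>" "?p \<sigma> (\<lambda>_. SZero) = \<sigma>" for \<sigma> :: "(real ^ 'd) set \<Rightarrow> sign"
    by auto
  have face: "A \<in> faces \<A> pos neg \<longleftrightarrow> (\<exists>\<sigma>. A = ?c \<sigma> \<and> ?c \<sigma> \<noteq> {})" for A
    by (auto simp: faces_def)
  have one_ne: "?c (\<lambda>_. SZero) \<noteq> {}" using one by blast
  show ?thesis
  proof (rule monoidI; unfold face_monoid_def monoid.simps partial_object.simps one)
    show "face_mult \<A> pos neg A B \<in> faces \<A> pos neg"
      if AB: "A \<in> faces \<A> pos neg" "B \<in> faces \<A> pos neg" for A B
    proof -
      obtain \<sigma> \<tau> where A: "A = ?c \<sigma>" "?c \<sigma> \<noteq> {}" and B: "B = ?c \<tau>" "?c \<tau> \<noteq> {}"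
        using AB unfolding face by blast
      show ?thesis
        using mult(2)[OF A(2) B(2)] unfolding A(1) B(1) mult(1)[OF A(2) B(2)] face by blast
    qed
    show "?c (\<lambda>_. SZero) \<in> faces \<A> pos neg"
      using one_ne unfolding face by blast
    show "face_mult \<A> pos neg (face_mult \<A> pos neg A B) C =
        face_mult \<A> pos neg A (face_mult \<A> pos neg B C)"
      if ABC: "A \<in> faces \<A> pos neg" "B \<in> faces \<A> pos neg" "C \<in> faces \<A> pos neg" for A B C
    proof -
      obtain \<sigma> \<tau> \<upsilon> where A: "A = ?c \<sigma>" "?c \<sigma> \<noteq> {}" and B: "B = ?c \<tau>" "?c \<tau> \<noteq> {}"
        and C: "C = ?c \<upsilon>" "?c \<upsilon> \<noteq> {}"
        using ABC unfolding face by blast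
      show ?thesis
        unfolding A(1) B(1) C(1) mult(1)[OF A(2) B(2)] mult(1)[OF B(2) C(2)]
          mult(1)[OF mult(2)[OF A(2) B(2)] C(2)] mult(1)[OF A(2) mult(2)[OF B(2) C(2)]]
          assoc ..
    qed
    show "face_mult \<A> pos neg (?c (\<lambda>_. SZero)) A = A" if "A \<in> faces \<A> pos neg" for A
      using that mult(1)[OF one_ne] unfolding face by (auto simp: id)
    show "face_mult \<A> pos neg A (?c (\<lambda>_. SZero)) = A" if "A \<in> faces \<A> pos neg" for A
      using that mult(1)[OF _ one_ne] unfolding face by (auto simp: id)
  qed
qed

end

theory Submission
  imports Defs
begin

text \<open>Colour a section by whether its first value lies in the right ideal \<open>aM\<close>. If \<open>aM\<close> and \<open>bM\<close>
  are disjoint, then for sections \<open>f\<close> and \<open>g\<close> with \<open>prec f g\<close> over \<open>M\<close> acting on itself, the products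
  \<open>a(f) g\<close> and \<open>b(f) g\<close> get different colours, so \<open>M\<close> is not Ramsey. In a non-trivial face monoid,
  the faces of some \<open>x \<noteq> 0\<close> and of \<open>-x\<close> have opposite signs at a hyperplane avoiding \<open>x\<close>, and right
  multiplication does not change non-zero signs.\<close>

lemma pointed_set_left_mult:
  assumes "monoid M"
  shows "pointed_set M (carrier M) (\<lambda>m x. m \<otimes>\<^bsub>M\<^esub> x) \<one>\<^bsub>M\<^esub>"
proof -
  interpret monoid M by fact
  show ?thesis
    by (auto simp: pointed_set_def monoid_action_def m_assoc image_iff)
qed

text \<open>The span requires only one multiplier to be the identity. The second factor supplies it,
  so the multiplier \<open>a\<close> of the first factor is free.\<close>

lemma two_term_product_in_ramsey_span:
  assumes "a \<in> carrier M" "\<one>\<^bsub>M\<^esub> \<in> carrier M"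
  shows "section_act act a (f 0) ++ section_act act \<one>\<^bsub>M\<^esub> (f 1) \<in> ramsey_span M act f"
proof -
  define m where "m j = (if j = 0 then a else \<one>\<^bsub>M\<^esub>)" for j :: nat
  have "section_act act a (f 0) ++ section_act act \<one>\<^bsub>M\<^esub> (f 1) =
      foldr (++) (map (\<lambda>j. section_act act (m j) (f (id j))) [0..<Suc 1]) Map.empty"
    by (simp add: m_def)
  moreover have "strict_mono_on {..1::nat} id"
    by (simp add: strict_mono_on_def)
  moreover have "\<forall>j\<le>1. m j \<in> carrier M" "\<exists>j\<le>1. m j = \<one>\<^bsub>M\<^esub>"
    using assms by (auto simp: m_def)
  ultimately show ?thesis
    unfolding ramsey_span_def by blast
qed

text \<open>All of \<open>dom f\<close> precedes \<open>dom g\<close>, so the least index of the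
  product is that of \<open>f\<close>, and \<open>g\<close>, although it takes precedence in
  \<open>++\<close>, is undefined there.\<close>

lemma first_value_map_add:
  assumes "prec f g" "finite (dom f)" "finite (dom g)"
  shows "(section_act act m f ++ section_act act m' g)
      (Min (dom (section_act act m f ++ section_act act m' g))) =
    map_option (act (Min (dom f)) m) (f (Min (dom f)))"
proof -
  have ne: "dom f \<noteq> {}" "dom g \<noteq> {}" and lt: "Max (dom f) < Min (dom g)"
    using assms(1) by (auto simp: prec_def)
  have "Min (dom f) \<le> Max (dom f)"
    using ne(1) assms(2) by simp
  then have less: "Min (dom f) < Min (dom g)"
    using lt by simp
  have "dom (section_act act m f ++ section_act act m' g) = dom f \<union> dom g"
    by (auto simp: section_act_def dom_def map_add_def split: option.splits)
  \<comment> \<open>The deleted rules would turn \<open>less\<close> into a statement about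
    elements; it is wanted as a comparison of the two minima.\<close>
  moreover have "Min (dom f \<union> dom g) = Min (dom f)"
    using ne less assms(2,3) by (subst Min_Un) (auto simp del: Min_less_iff Min_gr_iff)
  moreover have "Min (dom f) \<notin> dom g"
    using less assms(3) by (meson Min_le not_less)
  then have "g (Min (dom f)) = None"
    by auto
  ultimately show ?thesis
    by (simp add: section_act_def map_add_def)
qed

theorem not_ramsey_monoid_if_disjoint_right_ideals:
  fixes M :: "('m, 'e) monoid_scheme"
  assumes M: "monoid M" and a: "a \<in> carrier M" and b: "b \<in> carrier M"
    and disj: "\<And>x y. x \<in> carrier M \<Longrightarrow> y \<in> carrier M \<Longrightarrow> a \<otimes>\<^bsub>M\<^esub> x \<noteq> b \<otimes>\<^bsub>M\<^esub> y"
  shows "\<not> ramsey_monoid M"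
proof
  assume R: "ramsey_monoid M"
  interpret monoid M by fact
  define act :: "nat \<Rightarrow> 'm \<Rightarrow> 'm \<Rightarrow> 'm" where "act n m x = m \<otimes>\<^bsub>M\<^esub> x" for n m x
  \<comment> \<open>The empty section gets an unspecified one of the two colours; the sections
    compared below are nonempty.\<close>
  define c :: "(nat \<rightharpoonup> 'm) \<Rightarrow> nat" where
    "c f = (if the (f (Min (dom f))) \<in> (\<lambda>x. a \<otimes>\<^bsub>M\<^esub> x) ` carrier M then 1 else 0)" for f
  have "pointed_set M (carrier M) (act n) \<one>\<^bsub>M\<^esub>" for n
    using pointed_set_left_mult[OF M] by (simp add: act_def[abs_def])
  then have "ramsey_property M (\<lambda>_. carrier M) act (\<lambda>_. \<one>\<^bsub>M\<^esub>)"
    by (intro ramsey_monoidD[OF R])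
  moreover have "finite (c ` partial_sections (\<lambda>_. carrier M))"
    by (rule finite_subset[of _ "{0, 1}"]) (auto simp: c_def)
  ultimately obtain f r where f: "\<And>i. f i \<in> partial_sections (\<lambda>_. carrier M)"
    and prec: "\<And>i. prec (f i) (f (Suc i))"
    and mono: "\<And>g. g \<in> ramsey_span M act f \<Longrightarrow> c g = r"
    unfolding ramsey_property_def by blast
  have fin: "finite (dom (f i))" for i
    using f[of i] by (simp add: partial_sections_def)
  define n where "n = Min (dom (f 0))"
  have "n \<in> dom (f 0)"
    unfolding n_def using prec[of 0] fin[of 0] by (intro Min_in) (auto simp: prec_def)
  then obtain x where x: "f 0 n = Some x" "x \<in> carrier M"
    using f[of 0] by (force simp: partial_sections_def)
  \<comment> \<open>The value \<open>x\<close> stays fixed while \<open>m\<close> varies over the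
    whole monoid, so whether \<open>m\<close> times \<open>x\<close> lies in the right ideal of
    \<open>a\<close> cannot depend on \<open>m\<close>. Taking \<open>m\<close> to be
    \<open>a\<close> and then \<open>b\<close> contradicts this.\<close>
  have colour: "r = (if m \<otimes>\<^bsub>M\<^esub> x \<in> (\<lambda>x. a \<otimes>\<^bsub>M\<^esub> x) ` carrier M then 1 else 0)"
    if "m \<in> carrier M" for m
  proof -
    let ?g = "section_act act m (f 0) ++ section_act act \<one>\<^bsub>M\<^esub> (f 1)"
    have "?g (Min (dom ?g)) = Some (m \<otimes>\<^bsub>M\<^esub> x)"
      using first_value_map_add[of "f 0" "f 1" act m "\<one>\<^bsub>M\<^esub>"] prec[of 0] fin x
      by (simp add: n_def act_def)
    then show ?thesis
      using mono[OF two_term_product_in_ramsey_span[OF that one_closed]] by (simp add: c_def)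
  qed
  have "a \<otimes>\<^bsub>M\<^esub> x \<in> (\<lambda>x. a \<otimes>\<^bsub>M\<^esub> x) ` carrier M"
    using x(2) by (rule imageI)
  then have "r = 1"
    using colour[OF a] by (simp only: if_True)
  moreover have "b \<otimes>\<^bsub>M\<^esub> x \<notin> (\<lambda>x. a \<otimes>\<^bsub>M\<^esub> x) ` carrier M"
  proof
    assume "b \<otimes>\<^bsub>M\<^esub> x \<in> (\<lambda>x. a \<otimes>\<^bsub>M\<^esub> x) ` carrier M"
    then obtain y where "y \<in> carrier M" "b \<otimes>\<^bsub>M\<^esub> x = a \<otimes>\<^bsub>M\<^esub> y" by (rule imageE)
    then show False using disj[OF _ x(2)] by metis
  qed
  then have "r = 0"
    using colour[OF b] by (simp only: if_False)
  ultimately show False by simp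
qed

text \<open>The final \<open>SZero\<close> means that \<open>x\<close> lies on \<open>H\<close> once
  \<open>pos H\<close> and \<open>neg H\<close> are the two open sides of \<open>H\<close>.\<close>

definition point_sign :: "('a set \<Rightarrow> 'a set) \<Rightarrow> ('a set \<Rightarrow> 'a set) \<Rightarrow> 'a \<Rightarrow> 'a set \<Rightarrow> sign" where
  "point_sign pos neg x H = (if x \<in> pos H then SPos else if x \<in> neg H then SNeg else SZero)"

lemma mem_cell_point_sign:
  assumes "\<And>H. H \<in> \<A> \<Longrightarrow> half_spaces H (pos H) (neg H)"
  shows "x \<in> cell \<A> pos neg (point_sign pos neg x)"
  unfolding cell_def
proof
  fix H assume "H \<in> \<A>"
  then obtain a b where "H = {x. a \<bullet> x = b}" "pos H = {x. a \<bullet> x > b}" "neg H = {x. a \<bullet> x < b}"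
    using assms unfolding half_spaces_def by blast
  then show "x \<in> side pos neg H (point_sign pos neg x H)"
    by (auto simp: point_sign_def)
qed

text \<open>As \<open>H\<close> passes through the origin, it is the kernel of a linear functional,
  whose values at \<open>x\<close> and \<open>- x\<close> are nonzero and opposite.\<close>

lemma point_sign_uminus_neq:
  assumes hs: "half_spaces H (pos H) (neg H)" and "0 \<in> H" "x \<notin> H"
  shows "point_sign pos neg x H \<noteq> SZero" "point_sign pos neg (- x) H \<noteq> SZero"
    "point_sign pos neg x H \<noteq> point_sign pos neg (- x) H"
proof -
  obtain a b where ab: "H = {x. a \<bullet> x = b}" "pos H = {x. a \<bullet> x > b}" "neg H = {x. a \<bullet> x < b}"
    using hs unfolding half_spaces_def by blast
  then have b: "b = 0" using assms(2) by simp
  then have "a \<bullet> x \<noteq> 0" using assms(3) unfolding ab(1) by simp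
  then show "point_sign pos neg x H \<noteq> SZero" "point_sign pos neg (- x) H \<noteq> SZero"
    "point_sign pos neg x H \<noteq> point_sign pos neg (- x) H"
    unfolding point_sign_def ab(2,3) b by auto
qed

text \<open>A nonzero sign of the left factor at \<open>H\<close> survives in the product, and a
  cell lies in each of the sides that it intersects.\<close>

lemma face_mult_subset_side:
  fixes \<A> :: "(real ^ 'd) set set"
  assumes hs: "\<And>H. H \<in> \<A> \<Longrightarrow> half_spaces H (pos H) (neg H)"
    and ne: "cell \<A> pos neg \<sigma> \<noteq> {}" and F: "F \<in> faces \<A> pos neg"
    and H: "H \<in> \<A>" "\<sigma> H \<noteq> SZero"
  shows "face_mult \<A> pos neg (cell \<A> pos neg \<sigma>) F \<subseteq> side pos neg H (\<sigma> H)"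
proof -
  obtain \<tau> where F: "F = cell \<A> pos neg \<tau>" "cell \<A> pos neg \<tau> \<noteq> {}"
    using F by (auto simp: faces_def)
  have "face_mult \<A> pos neg (cell \<A> pos neg \<sigma>) F =
      cell \<A> pos neg (\<lambda>H. if \<sigma> H \<noteq> SZero then \<sigma> H else \<tau> H)"
    unfolding F(1) using face_mult_cell[of \<A> pos neg, OF hs ne F(2)] by blast
  also have "\<dots> \<subseteq> side pos neg H (\<sigma> H)"
    unfolding cell_def by (rule INF_lower2[OF H(1)]) (simp add: H(2))
  finally show ?thesis .
qed

theorem corollary5p3:
  fixes \<A> :: "(real ^ 'd) set set"
    and pos neg :: "(real ^ 'd) set \<Rightarrow> (real ^ 'd) set"
  assumes "finite \<A>"
    and "\<forall>H\<in>\<A>. hyperplane H"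
    and "\<forall>H\<in>\<A>. half_spaces H (pos H) (neg H)"
    and "\<Inter>\<A> = {0}"
    and "card (carrier (face_monoid \<A> pos neg)) > 1"
  shows "\<not> ramsey_monoid (face_monoid \<A> pos neg)"
proof -
  let ?M = "face_monoid \<A> pos neg"
  have hs: "\<And>H. H \<in> \<A> \<Longrightarrow> half_spaces H (pos H) (neg H)"
    using assms(3) by blast
  interpret monoid ?M
    using assms(1) hs assms(4) by (rule monoid_face_monoid)
  \<comment> \<open>Non-triviality enters here: a face other than \<open>{0}\<close> is nonempty,
    hence contains a nonzero point, and some hyperplane misses that point.\<close>
  have "\<not> faces \<A> pos neg \<subseteq> {{0}}"
    using assms(5) card_mono[of "{{0}}" "faces \<A> pos neg"] by (auto simp: face_monoid_def)
  then obtain F where "F \<in> faces \<A> pos neg" "F \<noteq> {0}" by blast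
  then have "F \<noteq> {}" "F \<noteq> {0}" by (auto simp: faces_def)
  then obtain x :: "real ^ 'd" where "x \<noteq> 0" by blast
  then obtain H where H: "H \<in> \<A>" "x \<notin> H" using assms(4) by blast
  have "0 \<in> H" using H(1) assms(4) by blast
  note signs = point_sign_uminus_neq[of H pos neg, OF hs[OF H(1)] this H(2)]
  define A where "A y = cell \<A> pos neg (point_sign pos neg y)" for y
  have ne: "A y \<noteq> {}" for y
    using mem_cell_point_sign[of \<A> pos neg y, OF hs] unfolding A_def by blast
  then have A: "A y \<in> carrier ?M" for y
    by (auto simp: face_monoid_def faces_def A_def)
  have sub: "A y \<otimes>\<^bsub>?M\<^esub> F \<subseteq> side pos neg H (point_sign pos neg y H)"
    if "F \<in> carrier ?M" "point_sign pos neg y H \<noteq> SZero" for F y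
    using face_mult_subset_side[OF hs ne[unfolded A_def] _ H(1) that(2)] that(1)
    by (simp add: face_monoid_def A_def)
  show ?thesis
  proof (rule not_ramsey_monoid_if_disjoint_right_ideals[OF monoid_axioms A[of x] A[of "- x"]])
    fix F G assume F: "F \<in> carrier ?M" and G: "G \<in> carrier ?M"
    show "A x \<otimes>\<^bsub>?M\<^esub> F \<noteq> A (- x) \<otimes>\<^bsub>?M\<^esub> G"
    proof
      assume eq: "A x \<otimes>\<^bsub>?M\<^esub> F = A (- x) \<otimes>\<^bsub>?M\<^esub> G"
      \<comment> \<open>Lying in different sides of \<open>H\<close> separates the two products only
        if they are nonempty; closure of the monoid ensures this.\<close>
      have "A x \<otimes>\<^bsub>?M\<^esub> F \<noteq> {}"
        using m_closed[OF A[of x] F] by (simp add: face_monoid_def faces_def)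
      then obtain z where "z \<in> A x \<otimes>\<^bsub>?M\<^esub> F" by blast
      then have "z \<in> side pos neg H (point_sign pos neg x H)"
        "z \<in> side pos neg H (point_sign pos neg (- x) H)"
        using sub[OF F signs(1)] sub[OF G signs(2)] eq by auto
      then show False
        using side_unique[of H pos neg z, OF hs[OF H(1)]] signs(3) by blast
    qed
  qed
qed

end
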